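(* Let $\psi:\mathbb{R}^m\to\mathbb{R}\cup\{+\infty\}$ be proper, lower semicontinuous and convex, let $p\ge1$ and $\lambda>0$, and let $\varepsilon_k\ge0$ for $k\in\mathbb{N}_0$. Let $\{y^k\}_{k\in\mathbb{N}_0}\subset\mathbb{R}^m$ be any sequence satisfying $$(\lambda\star\phi)\big(y^{k+1}-\operatorname{prox}_\psi^{\lambda\star\phi}(y^k)\big)\le\varepsilon_k\qquad\text{for all }k\in\mathbb{N}_0.$$ Then the following hold. (i) For all $k\in\mathbb{N}_0$, $$\operatorname{env}_\psi^{\lambda\star\phi}(y^{k+1})-\operatorname{env}_\psi^{\lambda\star\phi}(y^k)\le-(\lambda\star\phi)\big(y^k-\operatorname{prox}_\psi^{\lambda\star\phi}(y^k)\big)+\varepsilon_k.$$ (ii) If $\{\varepsilon_k\}$ is summable with $\sum_{k=0}^\infty\varepsilon_k\le\alpha$ for some $\alpha\ge0$, and the set of solutions $Y^\star=\operatorname{argmin}\psi$ is nonempty, then $\|y^{k+1}-y^k\|\to0$. (iii) If, in addition to the assumptions of (ii), $Y^\star$ is bounded, then $\{y^k\}_{k\in\mathbb{N}_0}$ remains bounded and all of its limit points lie in $Y^\star$. Moreover, if $\varepsilon_k=\frac{c}{(k+1)^{p+1}}$ for some $c\ge0$, then for every $y^\star\in Y^\star$ and all $k\ge1$ $$\operatorname{env}_\psi^{\lambda\star\phi}(y^k)-\operatorname{env}_\psi^{\lambda\star\phi}(y^\star)\le\frac{\lambda^{-p}D_\alpha^{p+1}(p^2+p)^p+c}{k^p},$$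 where $D_\alpha:=\sup\{\|y^\star-y\| : \operatorname{env}_\psi^{\lambda\star\phi}(y)\le\operatorname{env}_\psi^{\lambda\star\phi}(y^0)+\alpha\}$.
   Context: $\|\cdot\|$ denotes $\|\cdot\|_r$ on $\mathbb{R}^m$, where either $r=2$ or $r=p+1$, and $\phi:=\frac1{p+1}\|\cdot\|^{p+1}$. For $\lambda>0$ the epi-scaling is $(\lambda\star\phi)(x)=\lambda\phi(\lambda^{-1}x)=\lambda^{-p}\frac1{p+1}\|x\|^{p+1}$. The proximal mapping and the (left) anisotropic Moreau envelope of $\psi$ are $$\operatorname{prox}_\psi^{\lambda\star\phi}(y)=\operatorname*{argmin}_{\eta\in\mathbb{R}^m}\{\psi(\eta)+(\lambda\star\phi)(y-\eta)\},\qquad \operatorname{env}_\psi^{\lambda\star\phi}(y)=\inf_{\eta\in\mathbb{R}^m}\{\psi(\eta)+(\lambda\star\phi)(y-\eta)\}.$$ The minimizer defining the proximal mapping exists and is unique. *)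

theory Defs
  imports "HOL-Analysis.Analysis"
begin

text \<open>
  Functions into the extended reals. Convexity uses weights in the open interval (0,1) only; the
  right-hand side then never has the form \<open>\<infinity> - \<infinity>\<close> as long as the function avoids \<open>-\<infinity>\<close>, which
  is part of properness.
\<close>

definition proper_fun :: "('a \<Rightarrow> ereal) \<Rightarrow> bool" where
  "proper_fun f \<longleftrightarrow> (\<forall>x. f x \<noteq> -\<infinity>) \<and> (\<exists>x. f x \<noteq> \<infinity>)"

definition lsc_fun :: "('a::topological_space \<Rightarrow> ereal) \<Rightarrow> bool" where
  "lsc_fun f \<longleftrightarrow> (\<forall>x. f x \<le> Liminf (at x) f)"

definition convex_fun :: "('a::real_vector \<Rightarrow> ereal) \<Rightarrow> bool" where
  "convex_fun f \<longleftrightarrow>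
     (\<forall>x y t. 0 < t \<and> t < 1 \<longrightarrow>
        f ((1 - t) *\<^sub>R x + t *\<^sub>R y) \<le> ereal (1 - t) * f x + ereal t * f y)"

definition argmin_set :: "('a \<Rightarrow> ereal) \<Rightarrow> 'a set" where
  "argmin_set f = {x. is_arg_min f (\<lambda>_. True) x}"

definition r_norm :: "real \<Rightarrow> real ^ 'n \<Rightarrow> real" where
  "r_norm r x = (\<Sum>i\<in>UNIV. \<bar>x $ i\<bar> powr r) powr (1 / r)"

definition phi :: "real \<Rightarrow> real \<Rightarrow> real ^ 'n \<Rightarrow> real" where
  "phi r p x = 1 / (p + 1) * r_norm r x powr (p + 1)"

definition epi_scale :: "real \<Rightarrow> ('a::real_vector \<Rightarrow> real) \<Rightarrow> 'a \<Rightarrow> real" where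
  "epi_scale l f x = l * f (inverse l *\<^sub>R x)"

definition prox_obj ::
  "('a::real_vector \<Rightarrow> real) \<Rightarrow> ('a \<Rightarrow> ereal) \<Rightarrow> 'a \<Rightarrow> 'a \<Rightarrow> ereal" where
  "prox_obj h \<psi> y \<eta> = \<psi> \<eta> + ereal (h (y - \<eta>))"

text \<open>
  For proper lsc convex \<open>\<psi>\<close> and \<open>h\<close> an epi-scaled \<^const>\<open>phi\<close> (\<open>p \<ge> 1\<close>, \<open>r = 2\<close> or \<open>r = p + 1\<close>)
  the minimizer exists and is unique, so the description operator denotes it.
\<close>

definition prox :: "('a::real_vector \<Rightarrow> real) \<Rightarrow> ('a \<Rightarrow> ereal) \<Rightarrow> 'a \<Rightarrow> 'a" where
  "prox h \<psi> y = (THE \<eta>. \<eta> \<in> argmin_set (prox_obj h \<psi> y))"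

definition env :: "('a::real_vector \<Rightarrow> real) \<Rightarrow> ('a \<Rightarrow> ereal) \<Rightarrow> 'a \<Rightarrow> ereal" where
  "env h \<psi> y = (INF \<eta>. prox_obj h \<psi> y \<eta>)"

text \<open>
  The radius \<open>D\<^sub>\<alpha>\<close>. It is a real supremum: where it is used \<open>argmin \<psi>\<close> is nonempty and bounded,
  hence so is the sublevel set of the envelope.
\<close>

definition level_radius ::
  "real \<Rightarrow> (real ^ 'n \<Rightarrow> real) \<Rightarrow> (real ^ 'n \<Rightarrow> ereal) \<Rightarrow> real ^ 'n \<Rightarrow> real \<Rightarrow> real ^ 'n \<Rightarrow> real" where
  "level_radius r h \<psi> y0 \<alpha> ystar =
     Sup {r_norm r (ystar - x) |x. env h \<psi> x \<le> env h \<psi> y0 + ereal \<alpha>}"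

end

theory Submission
  imports Defs
begin

text \<open>
  Write \<open>h = C * N powr (p + 1)\<close>, where \<open>N\<close> is the norm and \<open>C = l powr (- p) / (p + 1)\<close>, write \<open>X\<close> for
  the proximal mapping, \<open>e\<close> for the envelope and \<open>m\<close> for the minimum of \<open>\<psi>\<close>.

  The proximal point exists because \<open>\<psi>\<close> has a lower bound that is linear in the Euclidean norm, which
  \<open>h\<close> outgrows, and it is unique because \<open>h\<close> is strictly convex. As \<open>X (y k)\<close> is a competitor in the
  infimum that defines \<open>e (y (Suc k))\<close>, the envelope decreases in each step by \<open>h (y k - X (y k))\<close>, up
  to the error \<open>\<epsilon> k\<close>. This is the first claim. If \<open>\<psi>\<close> has a minimizer then the envelope is bounded
  below; with summable errors the decreases are summable, so the residuals and the steps tend to \<open>0\<close>.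

  If moreover the set of minimizers is bounded, the growth of convex functions along rays bounds the
  sublevel sets of \<open>\<psi>\<close> and of the envelope, and thus the iterates and their distance \<open>D\<close> to a
  minimizer. Comparing \<open>X y\<close> with points slightly nearer to the minimizer gives a bound of the gap
  \<open>E = e y - m\<close> by the residual \<open>\<delta> = N (y - X y)\<close>, which implies \<open>E \<le> C * (p + 1) * \<delta> powr p * D\<close>
  (lemma \<open>envelope_gap\<close>). Hence the gap tends to \<open>0\<close>, and by lower semicontinuity all limit points
  minimize.

  For the rate, Young's inequality turns this bound and the decrease by \<open>C * \<delta> powr (p + 1)\<close> into
  affine recursions \<open>E' \<le> (1 - (p + 1) / n) * E + A / n powr (p + 1) + \<epsilon> k\<close> from one gap \<open>E\<close> to the
  next gap \<open>E'\<close>, one recursion for each real \<open>n > 0\<close>, with the constant \<open>A = l powr (- p) * D powr (p + 1) * (p\<^sup>2 + p) powr p\<close> of the claim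
  (lemma \<open>envelope_gap_linearized\<close>). The choice \<open>n = max (k + 1) (p + 1)\<close> keeps the factor of \<open>E\<close>
  nonnegative, so that an induction on \<open>k\<close> applies; it closes by Bernoulli's inequality
  (lemma \<open>rate_of_affine_recursions\<close>).
\<close>

section \<open>Real powers\<close>

text \<open>By the mean value theorem, since the derivative of \<open>t \<mapsto> t powr q\<close> is strictly increasing.\<close>

lemma powr_tangent_strict:
  fixes a b q :: real
  assumes "a \<ge> 0" "b \<ge> 0" "a \<noteq> b" "q > 1"
  shows "a powr q + q * a powr (q - 1) * (b - a) < b powr q"
proof -
  consider "a = 0" | "b = 0" "a > 0" | "0 < a" "a < b" | "0 < b" "b < a"
    using assms by linarith
  then show ?thesis
  proof cases
    case 1
    then show ?thesis using assms by simp
  next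
    case 2
    then have "a powr q = a powr (q - 1) * a"
      using powr_mult_base[of a "q - 1"] by (simp add: mult.commute)
    moreover have "0 < (q - 1) * (a powr (q - 1) * a)"
      using 2 assms by simp
    ultimately show ?thesis
      using 2 by (simp add: algebra_simps)
  next
    case 3
    then obtain z where z: "a < z" "z < b" "b powr q - a powr q = (b - a) * (q * z powr (q - 1))"
      using MVT2[of a b "\<lambda>x. x powr q" "\<lambda>x. q * x powr (q - 1)"]
      by (force intro: has_real_derivative_powr)
    have "a powr (q - 1) < z powr (q - 1)"
      using z 3 assms by (intro powr_less_mono2) auto
    then have "(q * a powr (q - 1)) * (b - a) < (q * z powr (q - 1)) * (b - a)"
      using 3 assms by simp
    then show ?thesis using z by (simp add: algebra_simps)
  next
    case 4
    then obtain z where z: "b < z" "z < a" "a powr q - b powr q = (a - b) * (q * z powr (q - 1))"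
      using MVT2[of b a "\<lambda>x. x powr q" "\<lambda>x. q * x powr (q - 1)"]
      by (force intro: has_real_derivative_powr)
    have "z powr (q - 1) < a powr (q - 1)"
      using z 4 assms by (intro powr_less_mono2) auto
    then have "(q * z powr (q - 1)) * (a - b) < (q * a powr (q - 1)) * (a - b)"
      using 4 assms by simp
    then show ?thesis using z by (simp add: algebra_simps)
  qed
qed

lemma powr_tangent:
  fixes a b q :: real
  assumes "a \<ge> 0" "b \<ge> 0" "q \<ge> 1"
  shows "a powr q + q * a powr (q - 1) * (b - a) \<le> b powr q"
proof (cases "a = b \<or> q = 1")
  case True
  then show ?thesis using assms by (cases "a = 0") auto
next
  case False
  then show ?thesis using powr_tangent_strict[of a b q] assms by simp
qed

lemma powr_convex_combination:
  fixes a b q t :: real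
  assumes "a \<ge> 0" "b \<ge> 0" "q \<ge> 1" "0 \<le> t" "t \<le> 1"
  shows "((1 - t) * a + t * b) powr q \<le> (1 - t) * a powr q + t * b powr q"
proof -
  define m where "m = (1 - t) * a + t * b"
  define s where "s = q * m powr (q - 1)"
  have "m \<ge> 0" using assms by (simp add: m_def)
  then have "(1 - t) * (m powr q + s * (a - m)) \<le> (1 - t) * a powr q"
    and "t * (m powr q + s * (b - m)) \<le> t * b powr q"
    using powr_tangent[of m a q] powr_tangent[of m b q] assms
    by (auto intro!: mult_left_mono simp: s_def)
  moreover have "(1 - t) * (m powr q + s * (a - m)) + t * (m powr q + s * (b - m)) = m powr q"
    by (simp add: m_def algebra_simps)
  ultimately show ?thesis by (simp add: m_def)
qed

lemma powr_midpoint_strict: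
  fixes a b q :: real
  assumes "a \<ge> 0" "b \<ge> 0" "a \<noteq> b" "q > 1"
  shows "((a + b) / 2) powr q < (a powr q + b powr q) / 2"
proof -
  define m where "m = (a + b) / 2"
  define s where "s = q * m powr (q - 1)"
  have m: "m \<ge> 0" "m \<noteq> a" "m \<noteq> b" using assms by (auto simp: m_def)
  have "m powr q + s * (a - m) < a powr q" "m powr q + s * (b - m) < b powr q"
    using powr_tangent_strict[of m a q] powr_tangent_strict[of m b q] assms m
    by (auto simp: s_def)
  moreover have "s * (a - m) + s * (b - m) = 0"
    by (simp add: m_def field_simps)
  ultimately show ?thesis by (simp add: m_def)
qed

text \<open>The tangent at \<open>a\<close> of the power \<open>p + 1\<close>, in the form of Young's inequality.\<close>

lemma Young_powr:
  fixes a b p :: real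
  assumes "a \<ge> 0" "b \<ge> 0" "p > 0"
  shows "(p + 1) * a powr p * b \<le> p * a powr (p + 1) + b powr (p + 1)"
proof -
  have "a powr (p + 1) = a * a powr p"
    using assms by (simp add: powr_mult_base add.commute)
  then show ?thesis
    using powr_tangent[of a b "p + 1"] assms by (simp add: algebra_simps)
qed

section \<open>Power norms\<close>

text \<open>
  Convexity of the real power, applied in every coordinate. The strict version at the midpoint is
  the source of uniqueness of the proximal point.
\<close>

lemma sum_powr_convex:
  fixes x y :: "real ^ 'n"
  assumes "r \<ge> 1" "0 \<le> t" "t \<le> 1"
  shows "(\<Sum>i\<in>UNIV. \<bar>((1 - t) *\<^sub>R x + t *\<^sub>R y) $ i\<bar> powr r)
    \<le> (1 - t) * (\<Sum>i\<in>UNIV. \<bar>x $ i\<bar> powr r) + t * (\<Sum>i\<in>UNIV. \<bar>y $ i\<bar> powr r)"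
proof -
  have "\<bar>(1 - t) * a + t * b\<bar> powr r \<le> (1 - t) * \<bar>a\<bar> powr r + t * \<bar>b\<bar> powr r" for a b :: real
  proof -
    have "\<bar>(1 - t) * a + t * b\<bar> \<le> (1 - t) * \<bar>a\<bar> + t * \<bar>b\<bar>"
      using abs_triangle_ineq[of "(1 - t) * a" "t * b"] assms by (simp add: abs_mult)
    then have "\<bar>(1 - t) * a + t * b\<bar> powr r \<le> ((1 - t) * \<bar>a\<bar> + t * \<bar>b\<bar>) powr r"
      using assms by (intro powr_mono2) auto
    also have "\<dots> \<le> (1 - t) * \<bar>a\<bar> powr r + t * \<bar>b\<bar> powr r"
      using assms by (intro powr_convex_combination) auto
    finally show ?thesis .
  qed
  then show ?thesis
    by (auto simp: sum_distrib_left sum.distrib[symmetric] intro!: sum_mono)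
qed

lemma sum_powr_midpoint_strict:
  fixes x y :: "real ^ 'n"
  assumes "r > 1" "x \<noteq> y"
  shows "(\<Sum>i\<in>UNIV. \<bar>((1 / 2) *\<^sub>R (x + y)) $ i\<bar> powr r)
    < ((\<Sum>i\<in>UNIV. \<bar>x $ i\<bar> powr r) + (\<Sum>i\<in>UNIV. \<bar>y $ i\<bar> powr r)) / 2"
proof -
  have le: "\<bar>(a + b) / 2\<bar> powr r \<le> ((\<bar>a\<bar> + \<bar>b\<bar>) / 2) powr r" for a b :: real
    using assms by (intro powr_mono2) auto
  have weak: "\<bar>(a + b) / 2\<bar> powr r \<le> (\<bar>a\<bar> powr r + \<bar>b\<bar> powr r) / 2" for a b :: real
    using le[of a b] powr_convex_combination[of "\<bar>a\<bar>" "\<bar>b\<bar>" r "1 / 2"] assms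
    by (simp add: field_simps)
  have strict: "\<bar>(a + b) / 2\<bar> powr r < (\<bar>a\<bar> powr r + \<bar>b\<bar> powr r) / 2" if "a \<noteq> b" for a b :: real
  proof (cases "\<bar>a\<bar> = \<bar>b\<bar>")
    case True
    with that have "b = - a" "a \<noteq> 0" by auto
    then show ?thesis by simp
  next
    case False
    then show ?thesis
      using le[of a b] powr_midpoint_strict[of "\<bar>a\<bar>" "\<bar>b\<bar>" r] assms by linarith
  qed
  obtain j where "x $ j \<noteq> y $ j"
    using assms by (auto simp: vec_eq_iff)
  then have "(\<Sum>i\<in>UNIV. \<bar>(x $ i + y $ i) / 2\<bar> powr r)
      < (\<Sum>i\<in>UNIV. (\<bar>x $ i\<bar> powr r + \<bar>y $ i\<bar> powr r) / 2)"
    using weak strict by (intro sum_strict_mono_ex1 ballI bexI[of _ j]) simp_all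
  then show ?thesis
    by (simp add: sum.distrib flip: sum_divide_distrib)
qed

lemma r_norm_nonneg: "0 \<le> r_norm r x"
  by (simp add: r_norm_def)

lemma r_norm_powr: "r > 0 \<Longrightarrow> r_norm r x powr r = (\<Sum>i\<in>UNIV. \<bar>x $ i\<bar> powr r)"
  by (simp add: r_norm_def powr_powr sum_nonneg)

lemma r_norm_scaleR:
  assumes "r > 0"
  shows "r_norm r (c *\<^sub>R x) = \<bar>c\<bar> * r_norm r x"
proof -
  have "(\<Sum>i\<in>UNIV. \<bar>(c *\<^sub>R x) $ i\<bar> powr r) = \<bar>c\<bar> powr r * (\<Sum>i\<in>UNIV. \<bar>x $ i\<bar> powr r)"
    by (simp add: abs_mult powr_mult sum_distrib_left)
  then show ?thesis
    using assms by (simp add: r_norm_def powr_mult powr_powr sum_nonneg)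
qed

lemma r_norm_eq_0D:
  assumes "r > 0" "r_norm r x = 0"
  shows "x = 0"
proof -
  have "(\<Sum>i\<in>UNIV. \<bar>x $ i\<bar> powr r) = 0"
    using assms by (simp add: r_norm_def)
  then have "\<forall>i. \<bar>x $ i\<bar> powr r = 0"
    by (subst (asm) sum_nonneg_eq_0_iff) auto
  then show ?thesis by (simp add: vec_eq_iff)
qed

lemma r_norm_le:
  assumes "r > 0" "a \<ge> 0" "(\<Sum>i\<in>UNIV. \<bar>x $ i\<bar> powr r) \<le> a powr r"
  shows "r_norm r x \<le> a"
proof -
  have "r_norm r x \<le> (a powr r) powr (1 / r)"
    unfolding r_norm_def using assms by (intro powr_mono2) (auto simp: sum_nonneg)
  then show ?thesis using assms by (simp add: powr_powr)
qed

text \<open>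
  Minkowski's inequality: \<open>(x + y) / (a + b)\<close> is a convex combination of the unit vectors \<open>x / a\<close>
  and \<open>y / b\<close>, where \<open>a\<close> and \<open>b\<close> are the norms of \<open>x\<close> and \<open>y\<close>.
\<close>

lemma r_norm_triangle:
  fixes x y :: "real ^ 'n"
  assumes "r \<ge> 1"
  shows "r_norm r (x + y) \<le> r_norm r x + r_norm r y"
proof (cases "r_norm r x = 0 \<or> r_norm r y = 0")
  case True
  then show ?thesis
    using r_norm_eq_0D[of r x] r_norm_eq_0D[of r y] assms by auto
next
  case False
  define a where "a = r_norm r x"
  define b where "b = r_norm r y"
  have pos: "a > 0" "b > 0"
    using False r_norm_nonneg[of r x] r_norm_nonneg[of r y] by (auto simp: a_def b_def)
  define t where "t = b / (a + b)"
  have t: "0 \<le> t" "t \<le> 1" "1 - t = a / (a + b)"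
    using pos by (auto simp: t_def field_simps)
  define u where "u = (1 / a) *\<^sub>R x"
  define v where "v = (1 / b) *\<^sub>R y"
  have "r_norm r u = 1" "r_norm r v = 1"
    using pos assms by (simp_all add: u_def v_def r_norm_scaleR flip: a_def b_def)
  then have "(\<Sum>i\<in>UNIV. \<bar>((1 - t) *\<^sub>R u + t *\<^sub>R v) $ i\<bar> powr r) \<le> 1"
    using sum_powr_convex[of r t u v] assms t
    by (simp add: r_norm_powr[symmetric])
  then have "r_norm r ((1 - t) *\<^sub>R u + t *\<^sub>R v) \<le> 1"
    using assms by (intro r_norm_le) auto
  moreover have "(1 - t) *\<^sub>R u + t *\<^sub>R v = (1 / (a + b)) *\<^sub>R (x + y)"
    using pos unfolding t(3) by (simp add: u_def v_def t_def scaleR_add_right)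
  ultimately have "r_norm r (x + y) / (a + b) \<le> 1"
    using pos assms r_norm_scaleR[of r "1 / (a + b)" "x + y"] by simp
  then show ?thesis
    using pos by (simp add: a_def b_def)
qed

lemma r_norm_rotund:
  fixes x y :: "real ^ 'n"
  assumes "r > 1" "r_norm r x = r_norm r y" "x \<noteq> y"
  shows "r_norm r (x + y) < r_norm r x + r_norm r y"
proof -
  have "(\<Sum>i\<in>UNIV. \<bar>((1 / 2) *\<^sub>R (x + y)) $ i\<bar> powr r) < r_norm r x powr r"
    using sum_powr_midpoint_strict[of r x y] assms by (simp add: r_norm_powr[symmetric])
  then have "r_norm r ((1 / 2) *\<^sub>R (x + y)) < (r_norm r x powr r) powr (1 / r)"
    unfolding r_norm_def[of r "(1 / 2) *\<^sub>R (x + y)"]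
    using assms by (intro powr_less_mono2) (auto intro: sum_nonneg)
  then have "r_norm r (x + y) / 2 < r_norm r x"
    using assms r_norm_nonneg[of r x] r_norm_scaleR[of r "1 / 2" "x + y"]
    by (simp add: powr_powr)
  then show ?thesis using assms by simp
qed

section \<open>Lower semicontinuous and convex functions\<close>

lemma lsc_fun_open_superlevel:
  assumes "lsc_fun f"
  shows "open {x. a < f x}"
proof (subst open_subopen, intro ballI)
  fix x assume "x \<in> {x. a < f x}"
  then have "a < f x" by simp
  also have "f x \<le> Liminf (at x) f"
    using assms by (simp add: lsc_fun_def)
  finally have "\<forall>\<^sub>F z in at x. a < f z" by (rule less_LiminfD)
  then have "\<forall>\<^sub>F z in nhds x. a < f z"
    unfolding eventually_at_filter by (rule eventually_mono) (use \<open>a < f x\<close> in auto)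
  then show "\<exists>T. open T \<and> x \<in> T \<and> T \<subseteq> {x. a < f x}"
    unfolding eventually_nhds by blast
qed

text \<open>
  A sum of two numbers exceeds \<open>a\<close> exactly if one exceeds some \<open>c\<close> and the other \<open>a - c\<close>; this
  writes each superlevel set of the sum as a union of open sets.
\<close>

lemma open_superlevel_add_continuous:
  fixes f :: "'a::topological_space \<Rightarrow> ereal" and g :: "'a \<Rightarrow> real"
  assumes "\<And>a. open {x. a < f x}" "continuous_on UNIV g"
  shows "open {x. a < f x + ereal (g x)}"
proof -
  have real: "open {x. ereal a < f x + ereal (g x)}" for a :: real
  proof -
    have "ereal a < f x + ereal (g x) \<longleftrightarrow> (\<exists>c. ereal c < f x \<and> a - c < g x)" for x
    proof (cases "f x")
      case (real v)
      show ?thesis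
      proof
        assume "ereal a < f x + ereal (g x)"
        then have "a < v + g x" by (simp add: real)
        then show "\<exists>c. ereal c < f x \<and> a - c < g x"
          by (intro exI[of _ "(v + (a - g x)) / 2"]) (simp add: real field_simps)
      qed (auto simp: real)
    next
      case PInf
      then show ?thesis by (auto intro!: exI[of _ "a - g x + 1"])
    qed auto
    then have "{x. ereal a < f x + ereal (g x)} = (\<Union>c. {x. ereal c < f x} \<inter> {x. a - c < g x})"
      by auto
    also have "open \<dots>"
      using assms(1) open_Collect_less[OF continuous_on_const assms(2)]
      by (intro open_UN ballI open_Int) auto
    finally show ?thesis .
  qed
  have "{x. a < f x + ereal (g x)} = (\<Union>c\<in>{c. a \<le> ereal c}. {x. ereal c < f x + ereal (g x)})"
  proof (intro subset_antisym subsetI)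
    fix x assume "x \<in> {x. a < f x + ereal (g x)}"
    then show "x \<in> (\<Union>c\<in>{c. a \<le> ereal c}. {x. ereal c < f x + ereal (g x)})"
      using ereal_dense2[of a "f x + ereal (g x)"] by (auto intro: less_imp_le)
  qed (auto intro: le_less_trans)
  also have "open \<dots>"
    using real by auto
  finally show ?thesis .
qed

text \<open>
  If no minimum is attained, the sets where \<open>f\<close> exceeds one of its values on \<open>K\<close> form an open cover
  of \<open>K\<close>; the point with the least value among those that index a finite subcover is not covered.
\<close>

lemma attains_min_on_compact:
  fixes f :: "'a::topological_space \<Rightarrow> ereal"
  assumes "\<And>a. open {x. a < f x}" "compact K" "K \<noteq> {}"
  shows "\<exists>x\<in>K. \<forall>z\<in>K. f x \<le> f z"
proof (rule ccontr)
  assume "\<not> ?thesis"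
  then have "\<forall>x\<in>K. \<exists>z\<in>K. f z < f x"
    by (simp add: not_le)
  then have cover: "K \<subseteq> (\<Union>w\<in>K. {z. f w < f z})"
    by blast
  obtain W where W: "W \<subseteq> K" "finite W" "K \<subseteq> (\<Union>w\<in>W. {z. f w < f z})"
    by (rule compactE_image[OF assms(2) _ cover]) (use assms(1) in auto)
  then have "W \<noteq> {}" using assms(3) by auto
  then obtain w where w: "w \<in> W" "\<forall>v\<in>W. f w \<le> f v"
    using ex_is_arg_min_if_finite[OF W(2), of f] by (auto simp: is_arg_min_linorder)
  then obtain v where "v \<in> W" "f v < f w" using W by blast
  with w show False by (meson leD)
qed

lemma attains_min_if_bounded_sublevel:
  fixes f :: "'a::euclidean_space \<Rightarrow> ereal"
  assumes "\<And>a. open {x. a < f x}" "bounded {x. f x \<le> f x0}"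
  shows "\<exists>x. \<forall>z. f x \<le> f z"
proof -
  have "closed {x. f x \<le> f x0}"
    using assms(1)[of "f x0"] by (simp add: closed_def Compl_eq not_le)
  then have "compact {x. f x \<le> f x0}"
    using assms(2) by (simp add: compact_eq_bounded_closed)
  then obtain x where x: "f x \<le> f x0" "\<And>z. f z \<le> f x0 \<Longrightarrow> f x \<le> f z"
    using attains_min_on_compact[of f "{x. f x \<le> f x0}"] assms(1) by auto
  have "f x \<le> f z" for z
    using x by (meson linear order_trans)
  then show ?thesis by blast
qed

text \<open>
  Along a ray a convex function lies, beyond any point of the ray, above the line through its values
  at the origin of the ray and at that point.
\<close>

lemma convex_fun_growth:
  fixes f :: "'a::real_normed_vector \<Rightarrow> ereal"
  assumes "convex_fun f" "f x0 = ereal a" "R > 0"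
    and sphere: "\<And>z. dist x0 z = R \<Longrightarrow> ereal m \<le> f z"
    and far: "dist x0 x \<ge> R"
  shows "ereal (a + (m - a) / R * dist x0 x) \<le> f x"
proof (cases "dist x0 x = R")
  case True
  then show ?thesis using sphere[of x] assms(3) by simp
next
  case False
  define t where "t = R / dist x0 x"
  have d: "dist x0 x > 0" using assms by linarith
  have t: "0 < t" "t < 1" using assms False d by (auto simp: t_def)
  define z where "z = (1 - t) *\<^sub>R x0 + t *\<^sub>R x"
  have "dist x0 z = norm (t *\<^sub>R (x0 - x))"
    by (simp add: z_def dist_norm algebra_simps)
  also have "\<dots> = R"
    using assms(3) d by (simp add: t_def dist_norm)
  finally have "ereal m \<le> f z" by (rule sphere)
  also have "f z \<le> ereal (1 - t) * f x0 + ereal t * f x"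
    using assms(1) t by (auto simp: convex_fun_def z_def)
  finally have le: "ereal m \<le> ereal ((1 - t) * a) + ereal t * f x"
    by (simp add: assms(2))
  show ?thesis
  proof (cases "f x")
    case (real v)
    then have "m \<le> (1 - t) * a + t * v" using le by simp
    then have "a + (m - a) / t \<le> v" using t by (simp add: field_simps)
    then show ?thesis using real assms(3) d by (simp add: t_def)
  next
    case MInf
    then show ?thesis using le t by simp
  qed simp
qed

lemma convex_lsc_linear_minorant:
  fixes f :: "'a::euclidean_space \<Rightarrow> ereal"
  assumes "proper_fun f" "lsc_fun f" "convex_fun f"
  obtains a b where "b \<ge> 0" "\<And>x. ereal (a - b * norm x) \<le> f x"
proof -
  obtain x0 v where x0: "f x0 = ereal v"
    using assms(1) unfolding proper_fun_def by (metis ereal_cases)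
  have "\<exists>w\<in>cball x0 1. \<forall>z\<in>cball x0 1. f w \<le> f z"
    using lsc_fun_open_superlevel[OF assms(2)] by (intro attains_min_on_compact) auto
  then obtain w where w: "\<And>z. z \<in> cball x0 1 \<Longrightarrow> f w \<le> f z"
    by blast
  have "f w \<noteq> \<infinity>" "f w \<noteq> -\<infinity>"
    using w[of x0] x0 assms(1) by (auto simp: proper_fun_def)
  then obtain m where m: "f w = ereal m" by (cases "f w") auto
  then have mv: "m \<le> v" using w[of x0] x0 by simp
  have low: "ereal (m - (v - m) * dist x0 x) \<le> f x" for x
  proof (cases "dist x0 x \<le> 1")
    case True
    then have "ereal m \<le> f x" using w[of x] m by simp
    moreover have "m - (v - m) * dist x0 x \<le> m" using mv by simp
    ultimately show ?thesis by (meson ereal_less_eq(3) order_trans)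
  next
    case False
    then have "ereal (v + (m - v) / 1 * dist x0 x) \<le> f x"
      using assms(3) x0 w m by (intro convex_fun_growth) auto
    moreover have "m - (v - m) * dist x0 x \<le> v + (m - v) / 1 * dist x0 x"
      using mv by (simp add: algebra_simps)
    ultimately show ?thesis by (meson ereal_less_eq(3) order_trans)
  qed
  show thesis
  proof
    show "v - m \<ge> 0" using mv by simp
    fix x
    have "(v - m) * dist x0 x \<le> (v - m) * (norm x0 + norm x)"
      using mv by (intro mult_left_mono) (auto simp: dist_norm norm_triangle_ineq4)
    then have "m - (v - m) * norm x0 - (v - m) * norm x \<le> m - (v - m) * dist x0 x"
      by (simp add: algebra_simps)
    then show "ereal (m - (v - m) * norm x0 - (v - m) * norm x) \<le> f x"
      using low[of x] by (meson ereal_less_eq(3) order_trans)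
  qed
qed

text \<open>
  On a sphere around a minimizer that encloses all minimizers the function exceeds its minimum by a
  positive amount, hence it grows at least linearly outside.
\<close>

lemma bounded_sublevel_if_bounded_argmin:
  fixes f :: "'a::euclidean_space \<Rightarrow> ereal"
  assumes "lsc_fun f" "convex_fun f"
    and "f x0 = ereal m" "\<And>x. ereal m \<le> f x" "bounded (argmin_set f)"
  shows "bounded {x. f x \<le> ereal M}"
proof -
  obtain R where R: "R > 0" "argmin_set f \<subseteq> ball x0 R"
    using bounded_subset_ballD[OF assms(5)] by blast
  obtain w where w: "dist x0 w = R" "\<And>z. dist x0 z = R \<Longrightarrow> f w \<le> f z"
    using attains_min_on_compact[of f "sphere x0 R"] lsc_fun_open_superlevel[OF assms(1)] R by auto
  have "w \<notin> argmin_set f" using R(2) w(1) by auto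
  then obtain v where "f v < f w"
    by (auto simp: argmin_set_def is_arg_min_def)
  then have "ereal m < f w"
    using assms(4)[of v] by (rule le_less_trans[rotated])
  then obtain c where c: "m < c" "ereal c < f w"
    using ereal_dense2[of "ereal m" "f w"] by auto
  have "dist x0 x \<le> max R ((M - m) * R / (c - m))" if "f x \<le> ereal M" for x
  proof (cases "dist x0 x \<le> R")
    case False
    then have "ereal (m + (c - m) / R * dist x0 x) \<le> f x"
      using w c R assms by (intro convex_fun_growth) (auto intro: less_imp_le less_le_trans)
    with that have "ereal (m + (c - m) / R * dist x0 x) \<le> ereal M" by (rule order_trans[rotated])
    then have "dist x0 x \<le> (M - m) * R / (c - m)"
      using R c by (simp add: field_simps)
    then show ?thesis by simp
  qed simp
  then show ?thesis by (auto simp: bounded_def)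
qed

section \<open>Proximal points for powers of a rotund norm\<close>

text \<open>
  Rotundity makes the triangle inequality strict for distinct vectors of equal norm. Since \<open>N 0 = 0\<close>,
  it also yields that \<open>N\<close> is definite.
\<close>

locale power_prox =
  fixes N :: "'a::euclidean_space \<Rightarrow> real" and C p :: real and \<psi> :: "'a \<Rightarrow> ereal"
  assumes N_triangle: "N (x + y) \<le> N x + N y"
    and N_scaleR: "N (c *\<^sub>R x) = \<bar>c\<bar> * N x"
    and N_rotund: "N x = N y \<Longrightarrow> x \<noteq> y \<Longrightarrow> N (x + y) < N x + N y"
    and C_pos: "C > 0" and p_ge_1: "p \<ge> 1"
    and proper: "proper_fun \<psi>" and lsc: "lsc_fun \<psi>" and convex: "convex_fun \<psi>"
begin

definition h :: "'a \<Rightarrow> real" where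
  "h x = C * N x powr (p + 1)"

lemma N_zero: "N 0 = 0"
  using N_scaleR[of 0 0] by simp

lemma N_minus: "N (- x) = N x"
  using N_scaleR[of "- 1" x] by simp

lemma N_diff_commute: "N (x - y) = N (y - x)"
  using N_minus[of "x - y"] by simp

lemma N_nonneg: "0 \<le> N x"
  using N_triangle[of x "- x"] by (simp add: N_zero N_minus)

lemma N_pos: "x \<noteq> 0 \<Longrightarrow> 0 < N x"
  using N_rotund[of x 0] N_nonneg[of x] by (cases "N x = 0") (auto simp: N_zero)

lemma N_continuous: "continuous_on S N"
proof -
  have "convex_on UNIV N"
  proof (rule convex_onI)
    fix t :: real and x y :: 'a
    assume "0 < t" "t < 1"
    then show "N ((1 - t) *\<^sub>R x + t *\<^sub>R y) \<le> (1 - t) * N x + t * N y"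
      using N_triangle[of "(1 - t) *\<^sub>R x" "t *\<^sub>R y"] by (simp add: N_scaleR)
  qed simp
  then show ?thesis
    using convex_on_continuous continuous_on_subset by blast
qed

text \<open>Homogeneity reduces the equivalence with the Euclidean norm to the compact unit sphere.\<close>

lemma norm_le_N:
  obtains K where "K > 0" "\<And>x. norm x \<le> K * N x"
proof -
  have "sphere (0::'a) 1 \<noteq> {}"
    by (metis SOME_Basis dist_0_norm empty_iff mem_sphere norm_Basis)
  then obtain u where u: "norm u = 1" "\<And>v. norm v = 1 \<Longrightarrow> N u \<le> N v"
    using continuous_attains_inf[of "sphere (0::'a) 1" N] N_continuous by auto
  then have pos: "N u > 0" by (intro N_pos) auto
  have "norm x \<le> 1 / N u * N x" for x
  proof (cases "x = 0")
    case False
    then have "N u \<le> N ((1 / norm x) *\<^sub>R x)" by (intro u) simp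
    then show ?thesis using False pos by (simp add: N_scaleR field_simps)
  qed (simp add: N_zero)
  with pos show thesis by (intro that[of "1 / N u"]) auto
qed

lemma N_le_norm:
  obtains K where "K > 0" "\<And>x. N x \<le> K * norm x"
proof -
  have "sphere (0::'a) 1 \<noteq> {}"
    by (metis SOME_Basis dist_0_norm empty_iff mem_sphere norm_Basis)
  then obtain u where u: "norm u = 1" "\<And>v. norm v = 1 \<Longrightarrow> N v \<le> N u"
    using continuous_attains_sup[of "sphere (0::'a) 1" N] N_continuous by auto
  then have pos: "N u > 0" by (intro N_pos) auto
  have "N x \<le> N u * norm x" for x
  proof (cases "x = 0")
    case False
    then have "N ((1 / norm x) *\<^sub>R x) \<le> N u" by (intro u) simp
    then show ?thesis using False pos by (simp add: N_scaleR field_simps)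
  qed (simp add: N_zero)
  with pos show thesis by (intro that[of "N u"]) auto
qed

lemma tendsto_zero_if_N:
  assumes "((\<lambda>k. N (f k)) \<longlongrightarrow> 0) F"
  shows "(f \<longlongrightarrow> 0) F"
proof -
  obtain K where K: "K > 0" "\<And>x. norm x \<le> K * N x" by (rule norm_le_N, rule that)
  have "((\<lambda>k. K * N (f k)) \<longlongrightarrow> 0) F"
    using tendsto_mult_right_zero[OF assms] by simp
  then show ?thesis
    by (rule Lim_null_comparison[rotated]) (simp add: K(2))
qed

lemma h_nonneg: "0 \<le> h x"
  using C_pos by (simp add: h_def)

lemma h_zero: "h 0 = 0"
  by (simp add: h_def N_zero)

lemma h_continuous: "continuous_on S h"
  unfolding h_def using p_ge_1
  by (intro continuous_intros continuous_on_powr' N_continuous) (auto simp: N_nonneg)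

lemma N_le_if_h_le:
  assumes "h x \<le> b"
  shows "N x \<le> (b / C) powr (1 / (p + 1))"
proof -
  have "N x powr (p + 1) \<le> b / C"
    using assms C_pos by (simp add: h_def field_simps)
  then have "(N x powr (p + 1)) powr (1 / (p + 1)) \<le> (b / C) powr (1 / (p + 1))"
    using p_ge_1 by (intro powr_mono2) auto
  then show ?thesis using p_ge_1 N_nonneg[of x] by (simp add: powr_powr)
qed

lemma N_tendsto_zero_if_h:
  assumes "((\<lambda>k. h (f k)) \<longlongrightarrow> 0) F"
  shows "((\<lambda>k. N (f k)) \<longlongrightarrow> 0) F"
proof -
  have "((\<lambda>k. (h (f k) / C) powr (1 / (p + 1))) \<longlongrightarrow> (0 / C) powr (1 / (p + 1))) F"
    using assms C_pos p_ge_1 by (intro tendsto_intros) (auto simp: h_nonneg)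
  then have "((\<lambda>k. (h (f k) / C) powr (1 / (p + 1))) \<longlongrightarrow> 0) F" by simp
  then show ?thesis
    by (rule Lim_null_comparison[rotated]) (simp add: N_nonneg N_le_if_h_le)
qed

text \<open>
  If \<open>N x\<close> and \<open>N y\<close> differ, strictness comes from the real power, otherwise from the rotundity of
  the norm.
\<close>

lemma h_midpoint_strict:
  assumes "x \<noteq> y"
  shows "h ((1 / 2) *\<^sub>R (x + y)) < (h x + h y) / 2"
proof -
  have mid: "N ((1 / 2) *\<^sub>R (x + y)) = N (x + y) / 2"
    by (simp add: N_scaleR)
  have "(N (x + y) / 2) powr (p + 1) < (N x powr (p + 1) + N y powr (p + 1)) / 2"
  proof (cases "N x = N y")
    case True
    then have "(N (x + y) / 2) powr (p + 1) < N x powr (p + 1)"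
      using N_rotund[OF True assms] p_ge_1 N_nonneg[of "x + y"] by (intro powr_less_mono2) auto
    then show ?thesis using True by simp
  next
    case False
    have "(N (x + y) / 2) powr (p + 1) \<le> ((N x + N y) / 2) powr (p + 1)"
      using N_triangle[of x y] p_ge_1 N_nonneg[of "x + y"] by (intro powr_mono2) auto
    also have "\<dots> < (N x powr (p + 1) + N y powr (p + 1)) / 2"
      using False p_ge_1 N_nonneg by (intro powr_midpoint_strict) auto
    finally show ?thesis .
  qed
  then have "C * (N (x + y) / 2) powr (p + 1) < C * ((N x powr (p + 1) + N y powr (p + 1)) / 2)"
    using C_pos by (intro mult_strict_left_mono)
  then show ?thesis unfolding h_def mid by (simp add: algebra_simps)
qed

text \<open>
  A tangent of the power \<open>p + 1\<close> with large slope makes \<open>h\<close> outgrow the linear lower bound of \<open>\<psi>\<close>.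
\<close>

lemma bounded_sublevel_prox_obj: "bounded {\<eta>. prox_obj h \<psi> y \<eta> \<le> ereal M}"
proof -
  obtain a b where ab: "b \<ge> 0" "\<And>x. ereal (a - b * norm x) \<le> \<psi> x"
    by (rule convex_lsc_linear_minorant[OF proper lsc convex], rule that)
  obtain K where K: "K > 0" "\<And>x. norm x \<le> K * N x" by (rule norm_le_N, rule that)
  define \<tau> where "\<tau> = ((b * K + 1) / (C * (p + 1))) powr (1 / p)"
  have "C * (p + 1) > 0" "b * K + 1 > 0"
    using C_pos p_ge_1 ab K by (auto intro: add_nonneg_pos)
  then have \<tau>: "\<tau> \<ge> 0" "C * (p + 1) * \<tau> powr p = b * K + 1"
    using p_ge_1 C_pos by (auto simp: \<tau>_def powr_powr)
  define S where "S = M - a + b * norm y + C * p * \<tau> powr (p + 1)"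
  have "norm \<eta> \<le> norm y + K * S" if le: "prox_obj h \<psi> y \<eta> \<le> ereal M" for \<eta>
  proof -
    define s where "s = N (y - \<eta>)"
    have s: "s \<ge> 0" by (simp add: s_def N_nonneg)
    have "ereal (a - b * norm \<eta> + h (y - \<eta>)) \<le> prox_obj h \<psi> y \<eta>"
      using add_right_mono[OF ab(2)[of \<eta>], of "ereal (h (y - \<eta>))"] by (simp add: prox_obj_def)
    then have "ereal (a - b * norm \<eta> + h (y - \<eta>)) \<le> ereal M"
      using le by (rule order_trans)
    then have 1: "a - b * norm \<eta> + C * s powr (p + 1) \<le> M"
      by (simp add: h_def s_def)
    have "C * ((p + 1) * \<tau> powr p * s) \<le> C * (p * \<tau> powr (p + 1) + s powr (p + 1))"
      using Young_powr[of \<tau> s p] \<tau> s p_ge_1 C_pos by (intro mult_left_mono) auto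
    then have 2: "(b * K + 1) * s \<le> C * p * \<tau> powr (p + 1) + C * s powr (p + 1)"
      unfolding \<tau>(2)[symmetric] by (simp add: algebra_simps)
    have "norm \<eta> \<le> norm y + norm (y - \<eta>)"
      using norm_triangle_ineq4[of y "y - \<eta>"] by simp
    then have 3: "norm \<eta> \<le> norm y + K * s"
      using K(2)[of "y - \<eta>"] by (simp add: s_def)
    have "b * norm \<eta> \<le> b * (norm y + K * s)"
      using 3 ab by (intro mult_left_mono)
    then have "s \<le> S"
      using 1 2 by (simp add: S_def algebra_simps)
    then have "K * s \<le> K * S" using K by simp
    then show ?thesis using 3 by simp
  qed
  then show ?thesis by (auto simp: bounded_iff)
qed

lemma prox_obj_lsc: "open {\<eta>. a < prox_obj h \<psi> y \<eta>}"
proof -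
  have "continuous_on UNIV (\<lambda>\<eta>. h (y - \<eta>))"
    by (rule continuous_on_compose2[OF h_continuous[of UNIV]]) (auto intro!: continuous_intros)
  then show ?thesis
    unfolding prox_obj_def
    by (intro open_superlevel_add_continuous lsc_fun_open_superlevel[OF lsc])
qed

lemma in_domain: obtains x0 v where "\<psi> x0 = ereal v"
  using proper unfolding proper_fun_def by (metis ereal_cases)

lemma psi_not_MInf: "\<psi> x \<noteq> -\<infinity>"
  using proper by (simp add: proper_fun_def)

lemma argmin_prox_obj_nonempty: "argmin_set (prox_obj h \<psi> y) \<noteq> {}"
proof -
  obtain x0 v where "\<psi> x0 = ereal v" by (rule in_domain)
  then have "prox_obj h \<psi> y x0 = ereal (v + h (y - x0))"
    by (simp add: prox_obj_def)
  then have "bounded {\<eta>. prox_obj h \<psi> y \<eta> \<le> prox_obj h \<psi> y x0}"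
    using bounded_sublevel_prox_obj[of y "v + h (y - x0)"] by simp
  then have "\<exists>x. \<forall>z. prox_obj h \<psi> y x \<le> prox_obj h \<psi> y z"
    by (rule attains_min_if_bounded_sublevel[OF prox_obj_lsc])
  then obtain x where "\<forall>z. prox_obj h \<psi> y x \<le> prox_obj h \<psi> y z" ..
  then have "x \<in> argmin_set (prox_obj h \<psi> y)"
    by (simp add: argmin_set_def is_arg_min_linorder)
  then show ?thesis by blast
qed

lemma argmin_prox_obj_le:
  assumes "x \<in> argmin_set (prox_obj h \<psi> y)"
  shows "prox_obj h \<psi> y x \<le> prox_obj h \<psi> y z"
  using assms by (simp add: argmin_set_def is_arg_min_linorder)

lemma argmin_prox_obj_finite:
  assumes "x \<in> argmin_set (prox_obj h \<psi> y)"
  obtains v where "\<psi> x = ereal v"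
proof -
  obtain x0 v where x0: "\<psi> x0 = ereal v" by (rule in_domain)
  have "\<psi> x \<noteq> \<infinity>"
    using argmin_prox_obj_le[OF assms, of x0] by (auto simp: prox_obj_def x0)
  with psi_not_MInf[of x] show thesis
    using that by (cases "\<psi> x") auto
qed

lemma argmin_prox_obj_unique:
  assumes "x \<in> argmin_set (prox_obj h \<psi> y)" "z \<in> argmin_set (prox_obj h \<psi> y)"
  shows "x = z"
proof (rule ccontr)
  assume "x \<noteq> z"
  obtain a where a: "\<psi> x = ereal a" by (rule argmin_prox_obj_finite[OF assms(1)])
  obtain b where b: "\<psi> z = ereal b" by (rule argmin_prox_obj_finite[OF assms(2)])
  note ab = a b
  define w where "w = (1 - 1 / 2) *\<^sub>R x + (1 / 2) *\<^sub>R z"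
  have psi_w: "\<psi> w \<le> ereal ((a + b) / 2)"
  proof -
    have "\<psi> w \<le> ereal (1 - 1 / 2) * \<psi> x + ereal (1 / 2) * \<psi> z"
      unfolding w_def by (rule convex[unfolded convex_fun_def, rule_format]) simp
    then show ?thesis by (simp add: ab add_divide_distrib)
  qed
  have "y - w = (1 / 2) *\<^sub>R ((y - x) + (y - z))"
    by (simp add: w_def algebra_simps flip: scaleR_left_distrib)
  then have h_w: "h (y - w) < (h (y - x) + h (y - z)) / 2"
    using h_midpoint_strict[of "y - x" "y - z"] \<open>x \<noteq> z\<close> by simp
  have obj_w: "prox_obj h \<psi> y w \<le> ereal ((a + b) / 2 + h (y - w))"
    using add_right_mono[OF psi_w, of "ereal (h (y - w))"] by (simp add: prox_obj_def)
  have "a + h (y - x) \<le> (a + b) / 2 + h (y - w)"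
    using order_trans[OF argmin_prox_obj_le[OF assms(1)] obj_w] by (simp add: prox_obj_def ab)
  moreover have "b + h (y - z) \<le> (a + b) / 2 + h (y - w)"
    using order_trans[OF argmin_prox_obj_le[OF assms(2)] obj_w] by (simp add: prox_obj_def ab)
  ultimately have "(a + h (y - x) + (b + h (y - z))) / 2 \<le> (a + b) / 2 + h (y - w)"
    by argo
  then show False using h_w by (simp add: field_simps)
qed

lemma prox_in_argmin: "prox h \<psi> y \<in> argmin_set (prox_obj h \<psi> y)"
proof -
  obtain x where x: "x \<in> argmin_set (prox_obj h \<psi> y)"
    using argmin_prox_obj_nonempty[of y] by blast
  then have "\<exists>!x. x \<in> argmin_set (prox_obj h \<psi> y)"
    by (rule ex1I) (rule argmin_prox_obj_unique[OF _ x])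
  then show ?thesis unfolding prox_def by (rule theI')
qed

abbreviation X :: "'a \<Rightarrow> 'a" where
  "X \<equiv> prox h \<psi>"

text \<open>
  The envelope and the value of \<open>\<psi>\<close> at the proximal point are finite. The names \<open>V\<close> and \<open>e\<close> stand for
  the corresponding reals, so that estimates do not involve extended arithmetic.
\<close>

definition V :: "'a \<Rightarrow> real" where
  "V y = real_of_ereal (\<psi> (X y))"

definition e :: "'a \<Rightarrow> real" where
  "e y = V y + h (y - X y)"

lemma psi_prox: "\<psi> (X y) = ereal (V y)"
  by (rule argmin_prox_obj_finite[OF prox_in_argmin[of y]]) (simp add: V_def)

lemma env_eq: "env h \<psi> y = ereal (e y)"
proof -
  have "env h \<psi> y = prox_obj h \<psi> y (X y)"
    unfolding env_def
    by (intro antisym INF_lower INF_greatest argmin_prox_obj_le prox_in_argmin) simp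
  then show ?thesis by (simp add: prox_obj_def psi_prox e_def)
qed

lemma e_le:
  assumes "\<psi> \<eta> \<le> ereal v"
  shows "e y \<le> v + h (y - \<eta>)"
proof -
  have "ereal (e y) \<le> prox_obj h \<psi> y \<eta>"
    using INF_lower[of \<eta> UNIV "prox_obj h \<psi> y"] by (simp add: env_def flip: env_eq)
  also have "\<dots> \<le> ereal (v + h (y - \<eta>))"
    using add_right_mono[OF assms, of "ereal (h (y - \<eta>))"] by (simp add: prox_obj_def)
  finally show ?thesis by simp
qed

lemma le_e:
  assumes "\<And>x. ereal m \<le> \<psi> x"
  shows "m \<le> V y" "m + h (y - X y) \<le> e y"
  using assms[of "X y"] by (auto simp: psi_prox e_def)

lemma e_minimizer:
  assumes "\<psi> ys = ereal m" "\<And>x. ereal m \<le> \<psi> x"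
  shows "e ys = m"
  using e_le[of ys m ys] le_e(2)[OF assms(2), of ys] h_nonneg[of "ys - X ys"] assms(1)
  by (simp add: h_zero)

text \<open>
  Compare the proximal point with its move by a fraction \<open>t\<close> towards \<open>ys\<close>. The optimality of the
  proximal point, the convexity of \<open>\<psi>\<close> and the triangle inequality bound the gap of \<open>\<psi>\<close> by a
  difference quotient of \<open>t \<mapsto> C * ((1 - t) * \<delta> + t * D) powr (p + 1)\<close>; now let \<open>t\<close> tend to \<open>0\<close>.
\<close>

lemma envelope_gap:
  fixes y ys :: 'a
  defines "\<delta> \<equiv> N (y - X y)"
  assumes "\<psi> ys = ereal m" "N (ys - y) \<le> D"
  shows "e y - m \<le> C * ((p + 1) * \<delta> powr p * (D - \<delta>) + \<delta> powr (p + 1))"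
proof -
  have D: "D \<ge> 0" using assms(3) N_nonneg[of "ys - y"] by simp
  have \<delta>: "\<delta> \<ge> 0" by (simp add: \<delta>_def N_nonneg)
  define z where "z t = (1 - t) * \<delta> + t * D" for t
  have quotient: "V y - m \<le> C * ((p + 1) * z t powr p * (D - \<delta>))" if t: "0 < t" "t < 1" for t
  proof -
    define w where "w = (1 - t) *\<^sub>R X y + t *\<^sub>R ys"
    have z: "z t \<ge> 0" using t \<delta> D by (simp add: z_def)
    have "\<psi> w \<le> ereal (1 - t) * \<psi> (X y) + ereal t * \<psi> ys"
      using convex t by (auto simp: convex_fun_def w_def)
    then have "e y \<le> (1 - t) * V y + t * m + h (y - w)"
      by (intro e_le) (simp add: psi_prox assms)
    then have "t * (V y - m) \<le> h (y - w) - C * \<delta> powr (p + 1)"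
      by (simp add: e_def h_def \<delta>_def algebra_simps)
    also have "h (y - w) \<le> C * z t powr (p + 1)"
    proof -
      have "y - w = (1 - t) *\<^sub>R (y - X y) + t *\<^sub>R (y - ys)"
        by (simp add: w_def algebra_simps)
      then have "N (y - w) \<le> (1 - t) * \<delta> + t * N (y - ys)"
        using N_triangle[of "(1 - t) *\<^sub>R (y - X y)" "t *\<^sub>R (y - ys)"] t
        by (simp add: N_scaleR \<delta>_def)
      also have "\<dots> \<le> z t"
        using t assms(3) by (simp add: z_def N_diff_commute)
      finally show ?thesis
        using C_pos p_ge_1 N_nonneg by (auto simp: h_def intro!: powr_mono2)
    qed
    also have "C * z t powr (p + 1) - C * \<delta> powr (p + 1) = C * (z t powr (p + 1) - \<delta> powr (p + 1))"
      by (simp add: right_diff_distrib)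
    also have "\<dots> \<le> C * ((p + 1) * z t powr p * (z t - \<delta>))"
      using powr_tangent[of "z t" \<delta> "p + 1"] z \<delta> p_ge_1 C_pos
      by (intro mult_left_mono) (auto simp: algebra_simps)
    also have "z t - \<delta> = t * (D - \<delta>)"
      by (simp add: z_def algebra_simps)
    finally have "t * (V y - m) \<le> t * (C * ((p + 1) * z t powr p * (D - \<delta>)))"
      by (simp only: mult.left_commute)
    then show ?thesis using t by simp
  qed
  have "((\<lambda>t. C * ((p + 1) * z t powr p * (D - \<delta>)))
      \<longlongrightarrow> C * ((p + 1) * ((1 - 0) * \<delta> + 0 * D) powr p * (D - \<delta>))) (at_right 0)"
    unfolding z_def using p_ge_1 \<delta> D
    by (intro tendsto_intros)
      (auto simp: eventually_at_right_field intro!: exI[of _ 1])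
  moreover have "\<forall>\<^sub>F t in at_right 0. V y - m \<le> C * ((p + 1) * z t powr p * (D - \<delta>))"
    using quotient by (auto simp: eventually_at_right_field intro!: exI[of _ 1])
  ultimately have "V y - m \<le> C * ((p + 1) * ((1 - 0) * \<delta> + 0 * D) powr p * (D - \<delta>))"
    by (intro tendsto_lowerbound) auto
  then show ?thesis
    by (simp add: e_def h_def \<delta>_def algebra_simps)
qed

text \<open>
  The gap is at most a multiple of \<open>\<delta> powr p\<close>, while one proximal step decreases it by a multiple of
  \<open>\<delta> powr (p + 1)\<close>. Young's inequality reconciles the exponents: for every \<open>n\<close>, the decrease is
  affinely bounded below in terms of the gap.
\<close>

lemma envelope_gap_linearized:
  assumes "\<psi> ys = ereal m" "N (ys - y) \<le> D" "n > 0"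
  shows "(p + 1) / n * (e y - m)
    \<le> h (y - X y) + C * (p + 1) * D powr (p + 1) * (p powr p * (p + 1) powr p) / n powr (p + 1)"
proof -
  define \<delta> where "\<delta> = N (y - X y)"
  define w where "w = (p + 1) * D / n"
  have D: "D \<ge> 0" using assms(2) N_nonneg[of "ys - y"] by simp
  have \<delta>: "\<delta> \<ge> 0" by (simp add: \<delta>_def N_nonneg)
  have w: "w \<ge> 0" using D assms p_ge_1 by (simp add: w_def)
  have "p * \<delta> powr (p + 1) \<ge> 0" using p_ge_1 by simp
  moreover have "\<delta> powr (p + 1) = \<delta> powr p * \<delta>"
    using powr_mult_base[OF \<delta>, of p] by (simp add: ac_simps)
  ultimately have "(p + 1) * \<delta> powr p * (D - \<delta>) + \<delta> powr (p + 1) \<le> (p + 1) * \<delta> powr p * D"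
    by (simp add: algebra_simps)
  then have "C * ((p + 1) * \<delta> powr p * (D - \<delta>) + \<delta> powr (p + 1)) \<le> C * ((p + 1) * \<delta> powr p * D)"
    using C_pos by simp
  then have "e y - m \<le> C * ((p + 1) * \<delta> powr p * D)"
    using envelope_gap[OF assms(1,2)] unfolding \<delta>_def by linarith
  then have "(p + 1) / n * (e y - m) \<le> (p + 1) / n * (C * ((p + 1) * \<delta> powr p * D))"
    using p_ge_1 assms by (intro mult_left_mono) auto
  also have "\<dots> = C * ((p + 1) * \<delta> powr p * w)"
    by (simp add: w_def)
  also have "\<dots> \<le> C * (\<delta> powr (p + 1) + p powr p * w powr (p + 1))"
  proof -
    \<comment> \<open>With \<open>\<delta> / p\<close> in place of \<open>\<delta>\<close>, multiplication by \<open>p powr p\<close> gives \<open>\<delta> powr (p + 1)\<close> the coefficient \<open>1\<close>.\<close>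
    have "p powr p * ((p + 1) * (\<delta> / p) powr p * w)
        \<le> p powr p * (p * (\<delta> / p) powr (p + 1) + w powr (p + 1))"
      using Young_powr[of "\<delta> / p" w p] \<delta> w p_ge_1 by (intro mult_left_mono) auto
    moreover have "p powr p * ((p + 1) * (\<delta> / p) powr p * w) = (p + 1) * \<delta> powr p * w"
      using p_ge_1 \<delta> by (simp add: powr_divide)
    moreover have "p powr p * (p * (\<delta> / p) powr (p + 1)) = \<delta> powr (p + 1)"
      using p_ge_1 \<delta> by (simp add: powr_divide powr_add)
    ultimately have "(p + 1) * \<delta> powr p * w \<le> \<delta> powr (p + 1) + p powr p * w powr (p + 1)"
      by (simp only: distrib_left)
    then show ?thesis using C_pos by simp
  qed
  also have "\<dots> = h (y - X y)
      + C * (p + 1) * D powr (p + 1) * (p powr p * (p + 1) powr p) / n powr (p + 1)"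
  proof -
    have "w powr (p + 1) = (p + 1) * (p + 1) powr p * D powr (p + 1) / n powr (p + 1)"
      using p_ge_1 D assms by (simp add: w_def powr_divide powr_mult powr_add)
    then show ?thesis by (simp add: h_def \<delta>_def algebra_simps)
  qed
  finally show ?thesis .
qed

text \<open>
  At a point of the sublevel set, the level bounds both the value of \<open>\<psi>\<close> at the proximal point and the
  distance to the proximal point.
\<close>

lemma bounded_sublevel_env:
  assumes "\<psi> ys = ereal m" "\<And>x. ereal m \<le> \<psi> x" "bounded (argmin_set \<psi>)"
  shows "bounded {y. e y \<le> M}"
proof -
  obtain B where B: "\<And>x. \<psi> x \<le> ereal M \<Longrightarrow> norm x \<le> B"
    using bounded_sublevel_if_bounded_argmin[OF lsc convex assms, of M]
    by (auto simp: bounded_iff)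
  obtain K where K: "K > 0" "\<And>x. norm x \<le> K * N x" by (rule norm_le_N, rule that)
  have "norm y \<le> B + K * ((M - m) / C) powr (1 / (p + 1))" if "e y \<le> M" for y
  proof -
    have "h (y - X y) \<le> M - m" "V y \<le> M"
      using le_e[OF assms(2), of y] h_nonneg[of "y - X y"] that by (auto simp: e_def)
    then have "norm (X y) \<le> B" "N (y - X y) \<le> ((M - m) / C) powr (1 / (p + 1))"
      using B[of "X y"] N_le_if_h_le by (auto simp: psi_prox)
    moreover have "norm y \<le> norm (X y) + norm (y - X y)"
      using norm_triangle_ineq[of "X y" "y - X y"] by simp
    ultimately show ?thesis
      using K(2)[of "y - X y"] mult_left_mono[of "N (y - X y)" "((M - m) / C) powr (1 / (p + 1))" K] K(1)
      by linarith
  qed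
  then show ?thesis by (auto simp: bounded_iff)
qed

end

section \<open>Inexact proximal iterations\<close>

text \<open>
  For \<open>k \<le> p\<close> the parameter \<open>n = p + 1\<close> removes the previous term altogether. For \<open>k > p\<close> the
  parameter \<open>n = k + 1\<close> gives the induction step, by Bernoulli's inequality in the form
  \<open>(k - p) * (1 + 1 / k) powr p \<le> k\<close>.
\<close>

lemma rate_of_affine_recursions:
  fixes E :: "nat \<Rightarrow> real" and p A c :: real
  assumes "p \<ge> 1" "A \<ge> 0" "c \<ge> 0"
    and rec: "\<And>k n. n > 0 \<Longrightarrow> E (Suc k)
      \<le> (1 - (p + 1) / n) * E k + A / n powr (p + 1) + c / (real k + 1) powr (p + 1)"
    and "k \<ge> 1"
  shows "E k \<le> (A + c) / real k powr p"
  using \<open>k \<ge> 1\<close>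
proof (induction k)
  case (Suc k)
  define K where "K = real k + 1"
  have K: "K \<ge> 1" "real (Suc k) = K" by (auto simp: K_def)
  show ?case
  proof (cases "real k \<le> p")
    case True
    have "E (Suc k) \<le> A / (p + 1) powr (p + 1) + c / K powr (p + 1)"
      using rec[of "p + 1" k] assms(1) by (simp add: K_def)
    also have "\<dots> \<le> A / K powr p + c / K powr p"
    proof (intro add_mono divide_left_mono)
      have "K powr p \<le> K powr (p + 1)" using K by (intro powr_mono) auto
      also have "\<dots> \<le> (p + 1) powr (p + 1)"
        using True assms(1) K by (intro powr_mono2) (auto simp: K_def)
      finally show "K powr p \<le> (p + 1) powr (p + 1)" .
      show "K powr p \<le> K powr (p + 1)" using K by (intro powr_mono) auto
    qed (use K assms in auto)
    finally show ?thesis using K by (simp add: add_divide_distrib)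
  next
    case False
    then have k: "real k > 0" "real k > p" "k \<ge> 1" using assms(1) by auto
    define S where "S = A + c"
    have S: "S \<ge> 0" using assms by (simp add: S_def)
    have Bernoulli: "(real k - p) / real k powr p \<le> real k / K powr p"
    proof -
      have "1 - p / K \<le> (real k / K) powr p"
        using powr_tangent[of 1 "real k / K" p] assms(1) K k by (simp add: K_def field_simps)
      moreover have "(real k - p) / real k \<le> 1 - p / K"
        using assms(1) K k by (simp add: K_def field_simps)
      ultimately have "(real k - p) / real k \<le> real k powr p / K powr p"
        using K k by (simp add: powr_divide)
      then show ?thesis using K k by (simp add: field_simps)
    qed
    have "E (Suc k) \<le> (1 - (p + 1) / K) * E k + S / K powr (p + 1)"
      using rec[of K k] K by (simp add: K_def S_def add_divide_distrib)
    also have "(1 - (p + 1) / K) * E k \<le> (1 - (p + 1) / K) * (S / real k powr p)"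
      using Suc.IH k K by (intro mult_left_mono) (auto simp: S_def K_def field_simps)
    also have "(1 - (p + 1) / K) * (S / real k powr p) = S / K * ((real k - p) / real k powr p)"
      using K by (simp add: K_def field_simps)
    also have "\<dots> \<le> S / K * (real k / K powr p)"
      using Bernoulli S K by (intro mult_left_mono) auto
    also have "S / K * (real k / K powr p) + S / K powr (p + 1) = S / K powr p"
    proof -
      have "K powr (p + 1) = K * K powr p" using K by (simp add: powr_add)
      then have "S / K * (real k / K powr p) + S / K powr (p + 1) = S * (real k + 1) / (K * K powr p)"
        by (simp add: algebra_simps add_divide_distrib)
      then show ?thesis using K by (simp flip: K_def)
    qed
    finally show ?thesis using K by (simp add: S_def)
  qed
qed simp

locale inexact_prox_iteration = power_prox +
  fixes y :: "nat \<Rightarrow> 'a" and \<epsilon> :: "nat \<Rightarrow> real"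
  assumes eps_nonneg: "0 \<le> \<epsilon> k"
    and inexact_step: "h (y (Suc k) - X (y k)) \<le> \<epsilon> k"
begin

text \<open>The proximal point of \<open>y k\<close> is a competitor in the infimum that defines the envelope at \<open>y (Suc k)\<close>.\<close>

lemma descent: "e (y (Suc k)) \<le> e (y k) - h (y k - X (y k)) + \<epsilon> k"
  using e_le[of "X (y k)" "V (y k)" "y (Suc k)"] inexact_step[of k] by (simp add: psi_prox e_def)

lemma e_plus_residuals_le:
  "e (y k) + (\<Sum>i<k. h (y i - X (y i))) \<le> e (y 0) + (\<Sum>i<k. \<epsilon> i)"
proof (induction k)
  case (Suc k)
  then show ?case using descent[of k] by simp
qed simp

context
  fixes ys :: 'a and m \<alpha> :: real
  assumes summable: "summable \<epsilon>" and sum_le: "(\<Sum>k. \<epsilon> k) \<le> \<alpha>"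
    and ys: "\<psi> ys = ereal m" and minimal: "ereal m \<le> \<psi> x"
begin

lemma partial_sum_le: "(\<Sum>i<k. \<epsilon> i) \<le> \<alpha>"
  using sum_le_suminf[OF summable, of "{..<k}"] eps_nonneg sum_le by simp

lemma e_le_initial: "e (y k) \<le> e (y 0) + \<alpha>"
  using e_plus_residuals_le[of k] partial_sum_le[of k] h_nonneg
    sum_nonneg[of "{..<k}" "\<lambda>i. h (y i - X (y i))"] by simp

lemma m_le_e: "m \<le> e (y k)"
  using le_e(2)[OF minimal, of "y k"] h_nonneg[of "y k - X (y k)"] by simp

lemma residual_tendsto_zero: "(\<lambda>k. N (y k - X (y k))) \<longlonglongrightarrow> 0"
proof -
  have "(\<Sum>i<k. h (y i - X (y i))) \<le> e (y 0) + \<alpha> - m" for k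
    using e_plus_residuals_le[of k] partial_sum_le[of k] m_le_e[of k] by simp
  then have "summable (\<lambda>k. h (y k - X (y k)))"
    by (intro summableI_nonneg_bounded) (auto simp: h_nonneg)
  then show ?thesis by (intro N_tendsto_zero_if_h summable_LIMSEQ_zero)
qed

lemma steps_tendsto_zero: "(\<lambda>k. N (y (Suc k) - y k)) \<longlonglongrightarrow> 0"
proof -
  have "(\<lambda>k. h (y (Suc k) - X (y k))) \<longlonglongrightarrow> 0"
    by (rule tendsto_sandwich[OF _ _ tendsto_const summable_LIMSEQ_zero[OF summable]])
      (auto simp: h_nonneg inexact_step)
  then have "(\<lambda>k. N (y (Suc k) - X (y k)) + N (y k - X (y k))) \<longlonglongrightarrow> 0"
    using tendsto_add[OF N_tendsto_zero_if_h residual_tendsto_zero] by simp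
  moreover have "N (y (Suc k) - y k) \<le> N (y (Suc k) - X (y k)) + N (y k - X (y k))" for k
    using N_triangle[of "y (Suc k) - X (y k)" "X (y k) - y k"] by (simp add: N_diff_commute)
  ultimately show ?thesis
    by (elim Lim_null_comparison[rotated]) (simp add: N_nonneg)
qed

context
  assumes argmin_bounded: "bounded (argmin_set \<psi>)"
begin

lemma iterates_bounded: "bounded (range y)"
  using bounded_sublevel_env[OF ys minimal argmin_bounded, of "e (y 0) + \<alpha>"]
  by (rule bounded_subset) (auto simp: e_le_initial)

lemma bdd_above_distances: "bdd_above {N (ys - x) |x. e x \<le> e (y 0) + \<alpha>}"
proof -
  obtain B where B: "\<And>x. e x \<le> e (y 0) + \<alpha> \<Longrightarrow> norm x \<le> B"
    using bounded_sublevel_env[OF ys minimal argmin_bounded, of "e (y 0) + \<alpha>"]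
    by (auto simp: bounded_iff)
  obtain K where K: "K > 0" "\<And>x. N x \<le> K * norm x" by (rule N_le_norm, rule that)
  have "N (ys - x) \<le> K * (norm ys + B)" if "e x \<le> e (y 0) + \<alpha>" for x
  proof -
    have "norm (ys - x) \<le> norm ys + B"
      using norm_triangle_ineq4[of ys x] B[OF that] by simp
    then show ?thesis
      using K mult_left_mono[of "norm (ys - x)" "norm ys + B" K] by (meson less_imp_le order_trans)
  qed
  then show ?thesis by (auto intro!: bdd_aboveI)
qed

lemma distance_le: "N (ys - y k) \<le> Sup {N (ys - x) |x. e x \<le> e (y 0) + \<alpha>}"
  by (rule cSup_upper[OF _ bdd_above_distances]) (use e_le_initial in auto)

lemma gap_tendsto_zero: "(\<lambda>k. e (y k)) \<longlonglongrightarrow> m"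
proof -
  define D where "D = Sup {N (ys - x) |x. e x \<le> e (y 0) + \<alpha>}"
  define d where "d k = N (y k - X (y k))" for k
  have "(\<lambda>k. C * ((p + 1) * d k powr p * (D - d k) + d k powr (p + 1)))
      \<longlonglongrightarrow> C * ((p + 1) * 0 powr p * (D - 0) + 0 powr (p + 1))"
    using residual_tendsto_zero p_ge_1 unfolding d_def
    by (intro tendsto_intros) (auto simp: N_nonneg)
  then have "(\<lambda>k. C * ((p + 1) * d k powr p * (D - d k) + d k powr (p + 1))) \<longlonglongrightarrow> 0"
    by simp
  then have "(\<lambda>k. e (y k) - m) \<longlonglongrightarrow> 0"
    using envelope_gap[OF ys distance_le] m_le_e
    by (intro Lim_null_comparison[of "\<lambda>k. e (y k) - m"]) (auto simp: D_def d_def)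
  then show ?thesis by (simp add: LIM_zero_iff)
qed

text \<open>
  The residuals vanish, so the proximal points have the same limit points as the iterates. At the
  proximal points \<open>\<psi>\<close> is at most the envelope, which tends to the minimum.
\<close>

lemma limit_point_minimizes:
  assumes "strict_mono s" "(y \<circ> s) \<longlonglongrightarrow> z"
  shows "z \<in> argmin_set \<psi>"
proof -
  have "(\<lambda>k. y (s k) - X (y (s k))) \<longlonglongrightarrow> 0"
    using LIMSEQ_subseq_LIMSEQ[OF tendsto_zero_if_N[OF residual_tendsto_zero] assms(1)]
    by (simp add: o_def)
  then have X_lim: "(\<lambda>k. X (y (s k))) \<longlonglongrightarrow> z"
    using tendsto_diff[OF assms(2)[unfolded o_def]] by fastforce
  have "\<psi> z \<le> ereal m"
  proof (rule ccontr)
    assume "\<not> \<psi> z \<le> ereal m"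
    then have "ereal m < \<psi> z" by simp
    then obtain c where c: "m < c" "ereal c < \<psi> z"
      using ereal_dense2[of "ereal m" "\<psi> z"] by auto
    have "\<forall>\<^sub>F k in sequentially. ereal c < \<psi> (X (y (s k)))"
      using topological_tendstoD[OF X_lim lsc_fun_open_superlevel[OF lsc, of "ereal c"]] c by simp
    moreover have "\<forall>\<^sub>F k in sequentially. e (y (s k)) < c"
      using order_tendstoD(2)[OF LIMSEQ_subseq_LIMSEQ[OF gap_tendsto_zero assms(1)] c(1)]
      by (simp add: o_def)
    ultimately have "\<forall>\<^sub>F k in sequentially. False"
    proof eventually_elim
      case (elim k)
      then show False using h_nonneg[of "y (s k) - X (y (s k))"] by (simp add: psi_prox e_def)
    qed
    then show False by simp
  qed
  then show ?thesis
    using minimal by (auto simp: argmin_set_def is_arg_min_linorder intro: order_trans)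
qed

lemma gap_rate:
  assumes "c \<ge> 0" "\<And>k. \<epsilon> k = c / (real k + 1) powr (p + 1)" "k \<ge> 1"
  defines "D \<equiv> Sup {N (ys - x) |x. e x \<le> e (y 0) + \<alpha>}"
  shows "e (y k) - m
    \<le> (C * (p + 1) * D powr (p + 1) * (p powr p * (p + 1) powr p) + c) / real k powr p"
proof (rule rate_of_affine_recursions[OF p_ge_1 _ assms(1) _ assms(3), of _ "\<lambda>k. e (y k) - m"])
  define A where "A = C * (p + 1) * D powr (p + 1) * (p powr p * (p + 1) powr p)"
  show "0 \<le> C * (p + 1) * D powr (p + 1) * (p powr p * (p + 1) powr p)"
    using C_pos p_ge_1 by simp
  fix k and n :: real
  assume "n > 0"
  then have "(p + 1) / n * (e (y k) - m) \<le> h (y k - X (y k)) + A / n powr (p + 1)"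
    unfolding A_def D_def by (intro envelope_gap_linearized[OF ys distance_le])
  then show "e (y (Suc k)) - m \<le> (1 - (p + 1) / n) * (e (y k) - m)
      + C * (p + 1) * D powr (p + 1) * (p powr p * (p + 1) powr p) / n powr (p + 1)
      + c / (real k + 1) powr (p + 1)"
    using descent[of k] by (simp add: A_def left_diff_distrib flip: assms(2))
qed

end

end

end

section \<open>Convergence\<close>

lemma epi_scale_phi:
  assumes "r > 0" "l > 0"
  shows "epi_scale l (phi r p) x = l powr (- p) / (p + 1) * r_norm r x powr (p + 1)"
proof -
  have norm_eq: "r_norm r (inverse l *\<^sub>R x) powr (p + 1) = r_norm r x powr (p + 1) / l powr (p + 1)"
    using assms powr_divide[of "r_norm r x" l "p + 1"]
    by (simp add: r_norm_scaleR r_norm_nonneg divide_inverse_commute)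
  have "epi_scale l (phi r p) x = l / l powr (p + 1) / (p + 1) * r_norm r x powr (p + 1)"
    unfolding epi_scale_def phi_def norm_eq by simp
  also have "l / l powr (p + 1) = l powr (- p)"
    using assms by (simp add: powr_add powr_minus field_simps)
  finally show ?thesis .
qed

theorem theorem3p5:
  fixes \<psi> :: "real ^ 'n \<Rightarrow> ereal"
    and r p l :: real
    and \<epsilon> :: "nat \<Rightarrow> real"
    and y :: "nat \<Rightarrow> real ^ 'n"
  defines "h \<equiv> epi_scale l (phi r p)"
  assumes "proper_fun \<psi>" and "lsc_fun \<psi>" and "convex_fun \<psi>"
    and "p \<ge> 1" and "l > 0"
    and "r = 2 \<or> r = p + 1"
    and "\<And>k. \<epsilon> k \<ge> 0"
    and "\<And>k. h (y (Suc k) - prox h \<psi> (y k)) \<le> \<epsilon> k"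
  shows
    "(\<forall>k. env h \<psi> (y (Suc k)) - env h \<psi> (y k)
            \<le> ereal (- h (y k - prox h \<psi> (y k)) + \<epsilon> k))
     \<and> (\<forall>\<alpha>\<ge>0. summable \<epsilon> \<and> (\<Sum>k. \<epsilon> k) \<le> \<alpha> \<and> argmin_set \<psi> \<noteq> {} \<longrightarrow>
          (\<lambda>k. r_norm r (y (Suc k) - y k)) \<longlonglongrightarrow> 0)
     \<and> (\<forall>\<alpha>\<ge>0. summable \<epsilon> \<and> (\<Sum>k. \<epsilon> k) \<le> \<alpha> \<and> argmin_set \<psi> \<noteq> {}
            \<and> bounded (argmin_set \<psi>) \<longrightarrow>
          bounded (range y)
          \<and> (\<forall>s z. strict_mono s \<and> (y \<circ> s) \<longlonglongrightarrow> z \<longrightarrow> z \<in> argmin_set \<psi>)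
          \<and> (\<forall>c\<ge>0. (\<forall>k. \<epsilon> k = c / (real k + 1) powr (p + 1)) \<longrightarrow>
               (\<forall>ystar\<in>argmin_set \<psi>. \<forall>k\<ge>1.
                  env h \<psi> (y k) - env h \<psi> ystar
                    \<le> ereal ((l powr (- p) * level_radius r h \<psi> (y 0) \<alpha> ystar powr (p + 1)
                                * (p\<^sup>2 + p) powr p + c)
                              / real k powr p))))"
proof -
  define C where "C = l powr (- p) / (p + 1)"
  have r: "r > 1" using assms by auto
  have pp: "power_prox (r_norm r) C p \<psi>"
  proof
    show "r_norm r (x + z) \<le> r_norm r x + r_norm r z" for x z :: "real ^ 'n"
      using r by (intro r_norm_triangle) simp
    show "r_norm r (x + z) < r_norm r x + r_norm r z" if "r_norm r x = r_norm r z" "x \<noteq> z"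
      for x z :: "real ^ 'n"
      using r that by (rule r_norm_rotund)
  qed (use r assms(2-6) in \<open>auto simp: C_def r_norm_scaleR\<close>)
  interpret P: power_prox "r_norm r" C p \<psi> by (rule pp)
  have h: "P.h = h"
    using r assms(6) by (intro ext, unfold P.h_def h_def) (simp add: epi_scale_phi C_def)
  interpret I: inexact_prox_iteration "r_norm r" C p \<psi> y \<epsilon>
    by unfold_locales (use assms(8,9) in \<open>auto simp: h\<close>)
  have env: "env h \<psi> z = ereal (P.e z)" for z
    using P.env_eq[of z] by (simp add: h)
  have min: "\<exists>m. \<psi> z = ereal m \<and> (\<forall>x. ereal m \<le> \<psi> x)" if "z \<in> argmin_set \<psi>" for z
  proof -
    have le: "\<psi> z \<le> \<psi> x" for x
      using that by (simp add: argmin_set_def is_arg_min_linorder)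
    obtain x v where "\<psi> x = ereal v" by (rule P.in_domain)
    then have "\<psi> z \<noteq> \<infinity>" using le[of x] by auto
    then obtain m where "\<psi> z = ereal m" using P.psi_not_MInf[of z] by (cases "\<psi> z") auto
    then show ?thesis using le by metis
  qed
  show ?thesis
  proof (intro conjI allI impI ballI)
    fix k
    show "env h \<psi> (y (Suc k)) - env h \<psi> (y k) \<le> ereal (- h (y k - prox h \<psi> (y k)) + \<epsilon> k)"
      using I.descent[of k] by (simp add: env h)
  next
    fix \<alpha> :: real
    assume *: "summable \<epsilon> \<and> (\<Sum>k. \<epsilon> k) \<le> \<alpha> \<and> argmin_set \<psi> \<noteq> {}"
    then obtain z m where "\<psi> z = ereal m" "\<And>x. ereal m \<le> \<psi> x" using min by blast
    then show "(\<lambda>k. r_norm r (y (Suc k) - y k)) \<longlonglongrightarrow> 0"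
      using * by (intro I.steps_tendsto_zero) auto
  next
    fix \<alpha> :: real
    assume *: "summable \<epsilon> \<and> (\<Sum>k. \<epsilon> k) \<le> \<alpha> \<and> argmin_set \<psi> \<noteq> {} \<and> bounded (argmin_set \<psi>)"
    then obtain z m where z: "\<psi> z = ereal m" "\<And>x. ereal m \<le> \<psi> x" using min by blast
    show "bounded (range y)"
      by (rule I.iterates_bounded[OF _ _ z]) (use * in auto)
    show "w \<in> argmin_set \<psi>" if "strict_mono s \<and> (y \<circ> s) \<longlonglongrightarrow> w" for s w
      by (rule I.limit_point_minimizes[OF _ _ z]) (use * that in auto)
    fix c :: real and ystar and k :: nat
    assume c: "0 \<le> c" "\<forall>k. \<epsilon> k = c / (real k + 1) powr (p + 1)" and "ystar \<in> argmin_set \<psi>" "1 \<le> k"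
    then obtain m where m: "\<psi> ystar = ereal m" "\<And>x. ereal m \<le> \<psi> x" using min by blast
    have D: "level_radius r h \<psi> (y 0) \<alpha> ystar
        = Sup {r_norm r (ystar - x) |x. P.e x \<le> P.e (y 0) + \<alpha>}"
      by (simp add: level_radius_def env)
    have "p * (p + 1) = p\<^sup>2 + p" by (simp add: power2_eq_square distrib_left)
    then have powers: "p powr p * (p + 1) powr p = (p\<^sup>2 + p) powr p" "C * (p + 1) = l powr (- p)"
      using assms(5) powr_mult[of p "p + 1" p] by (auto simp: C_def)
    have "P.e (y k) - m \<le> (C * (p + 1) * level_radius r h \<psi> (y 0) \<alpha> ystar powr (p + 1)
        * (p powr p * (p + 1) powr p) + c) / real k powr p"
      unfolding D by (rule I.gap_rate[OF _ _ m]) (use * c \<open>1 \<le> k\<close> in auto)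
    then show "env h \<psi> (y k) - env h \<psi> ystar
        \<le> ereal ((l powr (- p) * level_radius r h \<psi> (y 0) \<alpha> ystar powr (p + 1)
          * (p\<^sup>2 + p) powr p + c) / real k powr p)"
      unfolding powers by (simp add: env P.e_minimizer[OF m])
  qed
qed

end
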